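(* Let $m\ge0$, let $\phi$ be a real (smooth) scalar field on Minkowski spacetime satisfying $(\Box+m^2)\phi=0$, and for integers $p,q\ge0$ let $U_{(p,q)}$ be the tensor of rank $2+p+q$ with components $${U^{\alpha\beta}}_{\mu_1\ldots\mu_p\nu_1\ldots\nu_q}=\tfrac12\left({\phi^{,\alpha}}_{\mu_1\ldots\mu_p}{\phi^{,\beta}}_{\nu_1\ldots\nu_q}+{\phi^{,\beta}}_{\mu_1\ldots\mu_p}{\phi^{,\alpha}}_{\nu_1\ldots\nu_q}\right)-\tfrac12g^{\alpha\beta}\left({\phi^{,\lambda}}_{\mu_1\ldots\mu_p}\phi_{,\lambda\nu_1\ldots\nu_q}-m^2\phi_{,\mu_1\ldots\mu_p}\phi_{,\nu_1\ldots\nu_q}\right).$$ Then $U_{(p,q)}$ is symmetric in $(\alpha,\beta)$, completely symmetric in $(\mu_1,\ldots,\mu_p)$ and in $(\nu_1,\ldots,\nu_q)$, and satisfies the conservation law $${U^{\alpha\beta}}_{\mu_1\ldots\mu_p\nu_1\ldots\nu_q,\alpha}=0 .$$ Moreover, when $p=q=n$, for any timelike unit vector $u$, $${U^{\alpha\beta}}_{\mu_1\ldots\mu_n\nu_1\ldots\nu_n}u_\alpha u_\beta u^{\mu_1}\cdots u^{\mu_n}u^{\nu_1}\cdots u^{\nu_n}\ \ge\ 0 .$$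
   Context: Setting: Minkowski spacetime $\mathbb{R}^4$ with Galilean coordinates and metric $g_{\alpha\beta}=\mathrm{diag}(1,-1,-1,-1)$, used to raise and lower indices; commas denote partial derivatives, with $\phi_{,\mu_1\ldots\mu_p}=\partial_{\mu_1}\cdots\partial_{\mu_p}\phi$ (equal to $\phi$ if $p=0$) and ${\phi^{,\alpha}}_{\mu_1\ldots\mu_p}=g^{\alpha\lambda}\phi_{,\lambda\mu_1\ldots\mu_p}$; $\Box=g^{\alpha\beta}\partial_\alpha\partial_\beta$. Timelike unit vector: $g_{\alpha\beta}u^\alpha u^\beta=1$. *)

theory Defs
  imports "HOL-Analysis.Analysis"
begin

text \<open>
  Spacetime is \<^typ>\<open>real^4\<close>; the index type \<^typ>\<open>4\<close> has the elements \<open>0, 1, 2, 3\<close>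
  (with \<open>4 = 0\<close>), and \<open>0\<close> is the time index.
\<close>

definition minkowski :: "real^4^4" where
  "minkowski = (\<chi> \<alpha> \<beta>. if \<alpha> = \<beta> then (if \<alpha> = 0 then 1 else -1) else 0)"

text \<open>The metric is its own inverse, so it has the same components with upper and lower indices.\<close>

lemma minkowski_self_inverse: "minkowski ** minkowski = mat 1"
  unfolding minkowski_def matrix_matrix_mult_def mat_def
  by (simp add: vec_eq_iff if_distrib[of "\<lambda>a. a * _"] if_distrib[of "\<lambda>a. _ * a"] cong: if_cong)

definition lower_index :: "real^4 \<Rightarrow> real^4" where
  "lower_index u = (\<chi> \<alpha>. \<Sum>\<beta>\<in>UNIV. minkowski $ \<alpha> $ \<beta> * u $ \<beta>)"

definition timelike_unit :: "real^4 \<Rightarrow> bool" where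
  "timelike_unit u \<longleftrightarrow> (\<Sum>\<alpha>\<in>UNIV. \<Sum>\<beta>\<in>UNIV. minkowski $ \<alpha> $ \<beta> * u $ \<alpha> * u $ \<beta>) = 1"

definition partial :: "4 \<Rightarrow> (real^4 \<Rightarrow> real) \<Rightarrow> real^4 \<Rightarrow> real" where
  "partial i f x = deriv (\<lambda>t. f (x + t *\<^sub>R axis i 1)) 0"

text \<open>\<open>partials [\<mu>\<^sub>1, \<dots>, \<mu>\<^sub>p] \<phi>\<close> is \<open>\<partial>\<^sub>\<mu>\<^sub>1 \<dots> \<partial>\<^sub>\<mu>\<^sub>p \<phi>\<close>.\<close>

definition partials :: "4 list \<Rightarrow> (real^4 \<Rightarrow> real) \<Rightarrow> real^4 \<Rightarrow> real" where
  "partials is f = foldr partial is f"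

text \<open>
  Partial derivatives of all orders exist and are continuous. Existence has to be required
  separately, since \<^const>\<open>deriv\<close> is a total function.
\<close>

definition smooth :: "(real^4 \<Rightarrow> real) \<Rightarrow> bool" where
  "smooth f \<longleftrightarrow> (\<forall>is. continuous_on UNIV (partials is f) \<and>
     (\<forall>i x. (\<lambda>t::real. partials is f (x + t *\<^sub>R axis i 1)) differentiable (at 0)))"

definition wave_op :: "(real^4 \<Rightarrow> real) \<Rightarrow> real^4 \<Rightarrow> real" where
  "wave_op f x = (\<Sum>\<alpha>\<in>UNIV. \<Sum>\<beta>\<in>UNIV. minkowski $ \<alpha> $ \<beta> * partials [\<alpha>, \<beta>] f x)"

text \<open>\<open>upper_partials \<alpha> [\<mu>\<^sub>1, \<dots>, \<mu>\<^sub>p] \<phi>\<close> is \<open>g\<^sup>\<alpha>\<^sup>\<kappa> \<partial>\<^sub>\<kappa> \<partial>\<^sub>\<mu>\<^sub>1 \<dots> \<partial>\<^sub>\<mu>\<^sub>p \<phi>\<close>.\<close>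

definition upper_partials :: "4 \<Rightarrow> 4 list \<Rightarrow> (real^4 \<Rightarrow> real) \<Rightarrow> real^4 \<Rightarrow> real" where
  "upper_partials \<alpha> is f x = (\<Sum>\<kappa>\<in>UNIV. minkowski $ \<alpha> $ \<kappa> * partials (\<kappa> # is) f x)"

text \<open>
  The component of \<open>U\<^sub>(\<^sub>p\<^sub>,\<^sub>q\<^sub>)\<close> with upper indices \<open>\<alpha>, \<beta>\<close> and lower indices \<open>\<mu>s\<close>, \<open>\<nu>s\<close>,
  where \<open>p\<close> and \<open>q\<close> are the lengths of the lists.
\<close>

definition U_tensor ::
  "real \<Rightarrow> (real^4 \<Rightarrow> real) \<Rightarrow> 4 \<Rightarrow> 4 \<Rightarrow> 4 list \<Rightarrow> 4 list \<Rightarrow> real^4 \<Rightarrow> real" where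
  "U_tensor m \<phi> \<alpha> \<beta> \<mu>s \<nu>s x =
     1/2 * (upper_partials \<alpha> \<mu>s \<phi> x * upper_partials \<beta> \<nu>s \<phi> x
          + upper_partials \<beta> \<mu>s \<phi> x * upper_partials \<alpha> \<nu>s \<phi> x)
     - 1/2 * minkowski $ \<alpha> $ \<beta> *
         ((\<Sum>\<kappa>\<in>UNIV. upper_partials \<kappa> \<mu>s \<phi> x * partials (\<kappa> # \<nu>s) \<phi> x)
          - m\<^sup>2 * partials \<mu>s \<phi> x * partials \<nu>s \<phi> x)"

end

theory Submission
  imports Defs
begin

text \<open>
  Differentiating the Klein--Gordon equation shows that all partial derivatives of \<open>\<phi>\<close> are again
  solutions, so \<open>U\<^sub>(\<^sub>p\<^sub>,\<^sub>q\<^sub>)\<close> is the polarised energy-momentum tensor of the two solutions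
  \<open>a = \<partial>\<^sub>\<mu>\<^sub>1 \<dots> \<partial>\<^sub>\<mu>\<^sub>p \<phi>\<close> and \<open>b = \<partial>\<^sub>\<nu>\<^sub>1 \<dots> \<partial>\<^sub>\<nu>\<^sub>q \<phi>\<close>. Its divergence reduces, by symmetry of
  second derivatives, to multiples of \<open>(\<box> + m\<^sup>2) a\<close> and \<open>(\<box> + m\<^sup>2) b\<close>. Contraction with \<open>u\<close> gives
  the energy density of the field \<open>u\<^sup>\<mu>\<^sup>1 \<dots> u\<^sup>\<mu>\<^sup>n \<partial>\<^sub>\<mu>\<^sub>1 \<dots> \<partial>\<^sub>\<mu>\<^sub>n \<phi>\<close>, whose positivity is the inequality
  \<open>g(V, V) \<le> 2 (u \<cdot> V)\<^sup>2\<close> for a timelike unit vector \<open>u\<close>.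
\<close>

section \<open>Iterated partial derivatives of smooth functions\<close>

lemma smooth_continuous_on:
  assumes "smooth f"
  shows "continuous_on UNIV (partials is f)"
  using assms by (simp add: smooth_def)

lemma partials_Nil [simp]: "partials [] f = f"
  by (simp add: partials_def)

lemma partials_Cons [simp]: "partials (i # is) f = partial i (partials is f)"
  by (simp add: partials_def)

lemma partials_append: "partials (is @ js) f = partials is (partials js f)"
  by (simp add: partials_def)

lemma smooth_partials:
  assumes "smooth f"
  shows "smooth (partials is f)"
  using assms unfolding smooth_def by (simp flip: partials_append)

text \<open>\<open>smooth\<close> speaks only of the parameter value 0. Moving the base point along
  the line gives the derivative at every \<open>s\<close>, as the mean value theorem
  requires.\<close>

lemma has_real_derivative_partial:
  assumes "smooth f"
  shows "((\<lambda>t. f (x + t *\<^sub>R axis i 1)) has_real_derivative partial i f (x + s *\<^sub>R axis i 1)) (at s)"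
proof -
  have "(\<lambda>t. partials [] f ((x + s *\<^sub>R axis i 1) + t *\<^sub>R axis i 1)) differentiable (at 0)"
    using assms unfolding smooth_def by blast
  then have "((\<lambda>t. f (x + s *\<^sub>R axis i 1 + t *\<^sub>R axis i 1)) has_real_derivative
      partial i f (x + s *\<^sub>R axis i 1)) (at (s - s))"
    by (simp add: partial_def DERIV_deriv_iff_real_differentiable)
  then have "((\<lambda>t. f (x + s *\<^sub>R axis i 1 + (t - s) *\<^sub>R axis i 1)) has_real_derivative
      partial i f (x + s *\<^sub>R axis i 1)) (at s)"
    unfolding DERIV_shift[of _ _ s "- s", unfolded add_uminus_conv_diff] .
  then show ?thesis
    by (simp add: scaleR_diff_left)
qed

lemma has_real_derivative_partial_0:
  assumes "smooth f"
  shows "((\<lambda>t. f (x + t *\<^sub>R axis i 1)) has_real_derivative partial i f x) (at 0)"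
  using has_real_derivative_partial[OF assms, of x i 0] by simp

lemma partial_eqI:
  assumes "((\<lambda>t. f (x + t *\<^sub>R axis i 1)) has_real_derivative d) (at 0)"
  shows "partial i f x = d"
  unfolding partial_def using assms by (rule DERIV_imp_deriv)

section \<open>Symmetry of mixed partial derivatives\<close>

text \<open>The second difference is an \<open>i\<close>-difference of the
  \<open>j\<close>-increment of \<open>f\<close>. The mean value theorem in direction
  \<open>i\<close> turns it into a \<open>j\<close>-difference of \<open>partial i f\<close>, to
  which the theorem applies again.\<close>

lemma second_difference_mvt:
  assumes f: "smooth f" and "0 < h"
  obtains s t where "0 < s" "s < h" "0 < t" "t < h"
    "f (x + h *\<^sub>R axis i 1 + h *\<^sub>R axis j 1) - f (x + h *\<^sub>R axis i 1) - f (x + h *\<^sub>R axis j 1) + f x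
      = h\<^sup>2 * partial j (partial i f) (x + s *\<^sub>R axis i 1 + t *\<^sub>R axis j 1)"
proof -
  let ?e = "axis i 1 :: real^4" and ?e' = "axis j 1 :: real^4"
  have fi: "smooth (partial i f)"
    using smooth_partials[OF f, of "[i]"] by simp
  \<comment> \<open>The \<open>i\<close>-step is written last, the form that
    \<open>has_real_derivative_partial\<close> expects; \<open>add_ac\<close> restores the order
    afterwards.\<close>
  have "\<exists>s>0. s < h \<and>
      (f (x + h *\<^sub>R ?e' + h *\<^sub>R ?e) - f (x + h *\<^sub>R ?e)) - (f (x + h *\<^sub>R ?e' + 0 *\<^sub>R ?e) - f (x + 0 *\<^sub>R ?e))
        = (h - 0) * (partial i f (x + h *\<^sub>R ?e' + s *\<^sub>R ?e) - partial i f (x + s *\<^sub>R ?e))"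
    by (rule MVT2[OF \<open>0 < h\<close>, of "\<lambda>s. f (x + h *\<^sub>R ?e' + s *\<^sub>R ?e) - f (x + s *\<^sub>R ?e)"])
      (intro DERIV_diff has_real_derivative_partial f)
  then obtain s where s: "0 < s" "s < h"
    and eq1: "f (x + h *\<^sub>R ?e' + h *\<^sub>R ?e) - f (x + h *\<^sub>R ?e) - (f (x + h *\<^sub>R ?e') - f x)
        = h * (partial i f (x + h *\<^sub>R ?e' + s *\<^sub>R ?e) - partial i f (x + s *\<^sub>R ?e))"
    by auto
  have "\<exists>t>0. t < h \<and> partial i f (x + s *\<^sub>R ?e + h *\<^sub>R ?e') - partial i f (x + s *\<^sub>R ?e + 0 *\<^sub>R ?e')
      = (h - 0) * partial j (partial i f) (x + s *\<^sub>R ?e + t *\<^sub>R ?e')"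
    by (rule MVT2[OF \<open>0 < h\<close>, of "\<lambda>t. partial i f (x + s *\<^sub>R ?e + t *\<^sub>R ?e')"])
      (intro has_real_derivative_partial fi)
  then obtain t where t: "0 < t" "t < h"
    and eq2: "partial i f (x + s *\<^sub>R ?e + h *\<^sub>R ?e') - partial i f (x + s *\<^sub>R ?e)
      = h * partial j (partial i f) (x + s *\<^sub>R ?e + t *\<^sub>R ?e')"
    by auto
  have "f (x + h *\<^sub>R ?e + h *\<^sub>R ?e') - f (x + h *\<^sub>R ?e) - f (x + h *\<^sub>R ?e') + f x
      = h * (partial i f (x + s *\<^sub>R ?e + h *\<^sub>R ?e') - partial i f (x + s *\<^sub>R ?e))"
    using eq1 by (simp add: add_ac)
  also have "\<dots> = h\<^sup>2 * partial j (partial i f) (x + s *\<^sub>R ?e + t *\<^sub>R ?e')"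
    unfolding eq2 by (simp add: power2_eq_square)
  finally show thesis
    using that s t by blast
qed

text \<open>The second difference is symmetric in \<open>i\<close> and \<open>j\<close>, so the two
  mixed derivatives share a value at points arbitrarily near \<open>x\<close>; continuity carries
  the equality to \<open>x\<close>.\<close>

lemma partial_commute:
  assumes f: "smooth f"
  shows "partial i (partial j f) x = partial j (partial i f) x"
proof (rule ccontr)
  assume neq: "partial i (partial j f) x \<noteq> partial j (partial i f) x"
  \<comment> \<open>With half the gap as tolerance, no number is strictly within
    \<open>\<epsilon>\<close> of both derivatives at \<open>x\<close>.\<close>
  define \<epsilon> where "\<epsilon> = \<bar>partial i (partial j f) x - partial j (partial i f) x\<bar> / 2"
  have "\<epsilon> > 0" using neq by (simp add: \<epsilon>_def)
  have close: "\<exists>d>0. \<forall>y. dist y x < d \<longrightarrow> dist (partial k (partial l f) y) (partial k (partial l f) x) < \<epsilon>" for k l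
    using smooth_continuous_on[OF f, of "[k, l]"] \<open>\<epsilon> > 0\<close>
    by (auto simp: continuous_on_iff)
  obtain d1 where d1: "d1 > 0"
    "\<And>y. dist y x < d1 \<Longrightarrow> dist (partial i (partial j f) y) (partial i (partial j f) x) < \<epsilon>"
    using close by blast
  obtain d2 where d2: "d2 > 0"
    "\<And>y. dist y x < d2 \<Longrightarrow> dist (partial j (partial i f) y) (partial j (partial i f) x) < \<epsilon>"
    using close by blast
  \<comment> \<open>The halving allows for two steps, each shorter than \<open>h\<close>, away from
    \<open>x\<close>.\<close>
  define h where "h = min d1 d2 / 2"
  have "h > 0" using d1 d2 by (simp add: h_def)
  have near: "dist (x + s *\<^sub>R axis k 1 + t *\<^sub>R axis l 1) x < 2 * h"
    if "0 < s" "s < h" "0 < t" "t < h" for s t k l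
  proof -
    have "dist (x + s *\<^sub>R axis k 1 + t *\<^sub>R axis l 1) x
        \<le> norm (s *\<^sub>R (axis k 1 :: real^4)) + norm (t *\<^sub>R (axis l 1 :: real^4))"
      using norm_triangle_ineq[of "s *\<^sub>R (axis k 1 :: real^4)" "t *\<^sub>R axis l 1"]
      by (simp add: dist_norm algebra_simps)
    then show ?thesis using that by simp
  qed
  obtain s t where st: "0 < s" "s < h" "0 < t" "t < h"
    "f (x + h *\<^sub>R axis i 1 + h *\<^sub>R axis j 1) - f (x + h *\<^sub>R axis i 1) - f (x + h *\<^sub>R axis j 1) + f x
      = h\<^sup>2 * partial j (partial i f) (x + s *\<^sub>R axis i 1 + t *\<^sub>R axis j 1)"
    by (rule second_difference_mvt[OF f \<open>h > 0\<close>])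
  obtain s' t' where st': "0 < s'" "s' < h" "0 < t'" "t' < h"
    "f (x + h *\<^sub>R axis j 1 + h *\<^sub>R axis i 1) - f (x + h *\<^sub>R axis j 1) - f (x + h *\<^sub>R axis i 1) + f x
      = h\<^sup>2 * partial i (partial j f) (x + s' *\<^sub>R axis j 1 + t' *\<^sub>R axis i 1)"
    by (rule second_difference_mvt[OF f \<open>h > 0\<close>])
  have "h\<^sup>2 * partial j (partial i f) (x + s *\<^sub>R axis i 1 + t *\<^sub>R axis j 1)
      = h\<^sup>2 * partial i (partial j f) (x + s' *\<^sub>R axis j 1 + t' *\<^sub>R axis i 1)"
    unfolding st(5)[symmetric] st'(5)[symmetric] by (simp add: add_ac)
  then have eq: "partial j (partial i f) (x + s *\<^sub>R axis i 1 + t *\<^sub>R axis j 1)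
      = partial i (partial j f) (x + s' *\<^sub>R axis j 1 + t' *\<^sub>R axis i 1)"
    using \<open>h > 0\<close> by simp
  have "dist (partial j (partial i f) (x + s *\<^sub>R axis i 1 + t *\<^sub>R axis j 1)) (partial j (partial i f) x) < \<epsilon>"
    using near[OF st(1-4), of i j] by (intro d2(2)) (simp add: h_def)
  moreover have "dist (partial i (partial j f) (x + s' *\<^sub>R axis j 1 + t' *\<^sub>R axis i 1))
      (partial i (partial j f) x) < \<epsilon>"
    using near[OF st'(1-4), of j i] by (intro d1(2)) (simp add: h_def)
  ultimately show False
    unfolding eq \<epsilon>_def dist_real_def by (smt (verit) field_sum_of_halves)
qed

text \<open>The head of \<open>is\<close> occurs in \<open>js\<close> and can be commuted to the
  front there; induction handles the rest. The complete symmetry in each group of lower indices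
  comes from here.\<close>

lemma partials_mset_cong:
  assumes f: "smooth f" and "mset is = mset js"
  shows "partials is f = partials js f"
  using assms(2)
proof (induction "is" arbitrary: js)
  case Nil
  then show ?case by simp
next
  case (Cons i "is")
  have "i \<in> set js"
    using Cons.prems by (metis list.set_intros(1) mset_eq_setD)
  then obtain ks ls where js: "js = ks @ i # ls"
    by (meson split_list)
  have move: "partial i (partials ks (partials ls f)) = partials ks (partial i (partials ls f))" for ks
  proof (induction ks)
    case (Cons k ks)
    have "partial i (partial k (partials ks (partials ls f)))
        = partial k (partial i (partials ks (partials ls f)))"
      by (intro ext partial_commute smooth_partials f)
    with Cons show ?case by simp
  qed simp
  have "partials is f = partials (ks @ ls) f"
    using Cons.prems js by (intro Cons.IH) simp
  then show ?case
    using move by (simp add: js partials_append)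
qed

lemma partials_permute_list:
  assumes "smooth f" "\<sigma> permutes {..<length is}"
  shows "partials (permute_list \<sigma> is) f = partials is f"
  using assms by (intro partials_mset_cong) simp_all

section \<open>Contraction with the diagonal metric\<close>

text \<open>The diagonal entry stays symbolic, so that contractions collapse to one term without
  separating time from space.\<close>

lemma minkowski_nth: "minkowski $ \<alpha> $ \<beta> = (if \<alpha> = \<beta> then minkowski $ \<alpha> $ \<alpha> else 0)"
  by (simp add: minkowski_def)

lemma sum_UNIV_4: "sum f (UNIV::4 set) = f 0 + f 1 + f 2 + f 3"
proof -
  have "(4::4) = 0" by simp
  then show ?thesis by (simp only: sum_4 add_ac)
qed

lemma sum_minkowski: "(\<Sum>\<beta>\<in>UNIV. minkowski $ \<alpha> $ \<beta> * f \<beta>) = minkowski $ \<alpha> $ \<alpha> * f \<alpha>"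
  by (subst minkowski_nth) (simp add: if_distrib[of "\<lambda>a. a * _"] cong: if_cong)

lemma sum_minkowski': "(\<Sum>\<alpha>\<in>UNIV. minkowski $ \<alpha> $ \<beta> * f \<alpha>) = minkowski $ \<beta> $ \<beta> * f \<beta>"
  by (subst minkowski_nth) (simp add: if_distrib[of "\<lambda>a. a * _"] cong: if_cong)

lemma wave_op_eq: "wave_op f x = (\<Sum>\<alpha>\<in>UNIV. minkowski $ \<alpha> $ \<alpha> * partial \<alpha> (partial \<alpha> f) x)"
  by (simp add: wave_op_def sum_minkowski)

lemma upper_partials_eq: "upper_partials \<alpha> is f x = minkowski $ \<alpha> $ \<alpha> * partial \<alpha> (partials is f) x"
  by (simp add: upper_partials_def sum_minkowski)

lemma upper_partials_permute_list:
  assumes "smooth f" "\<sigma> permutes {..<length is}"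
  shows "upper_partials \<alpha> (permute_list \<sigma> is) f = upper_partials \<alpha> is f"
  by (simp add: fun_eq_iff upper_partials_eq partials_permute_list[OF assms])

section \<open>Derivatives of solutions are solutions\<close>

text \<open>The wave operator has constant coefficients, and partial derivatives commute.\<close>

lemma wave_op_partial:
  assumes f: "smooth f"
  shows "wave_op (partial i f) x = partial i (wave_op f) x"
proof -
  have swap: "partial i (partial \<alpha> (partial \<alpha> f)) = partial \<alpha> (partial \<alpha> (partial i f))" for \<alpha>
    using partials_mset_cong[OF f, of "[i, \<alpha>, \<alpha>]" "[\<alpha>, \<alpha>, i]"] by simp
  have "((\<lambda>t. wave_op f (x + t *\<^sub>R axis i 1)) has_real_derivative
      (\<Sum>\<alpha>\<in>UNIV. minkowski $ \<alpha> $ \<alpha> * partial i (partial \<alpha> (partial \<alpha> f)) x)) (at 0)"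
    unfolding wave_op_eq
    using smooth_partials[OF f, of "[\<alpha>, \<alpha>]" for \<alpha>]
    by (intro DERIV_sum DERIV_cmult has_real_derivative_partial_0) simp
  then have "partial i (wave_op f) x = (\<Sum>\<alpha>\<in>UNIV. minkowski $ \<alpha> $ \<alpha> * partial i (partial \<alpha> (partial \<alpha> f)) x)"
    by (rule partial_eqI)
  then show ?thesis by (simp add: wave_op_eq swap)
qed

lemma klein_gordon_partials:
  assumes f: "smooth f" and kg: "\<And>x. wave_op f x + m\<^sup>2 * f x = 0"
  shows "wave_op (partials is f) x + m\<^sup>2 * partials is f x = 0"
proof (induction "is" arbitrary: x)
  case Nil
  then show ?case using kg by simp
next
  case (Cons i "is")
  let ?a = "partials is f"
  have a: "smooth ?a" using f by (rule smooth_partials)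
  \<comment> \<open>The induction hypothesis holds at every point, so it is an equality of functions
    and may be differentiated.\<close>
  have "wave_op ?a = (\<lambda>x. - m\<^sup>2 * ?a x)"
    using Cons.IH by (auto simp: fun_eq_iff eq_neg_iff_add_eq_0)
  then have "partial i (wave_op ?a) x = - m\<^sup>2 * partial i ?a x"
    using DERIV_cmult[OF has_real_derivative_partial_0[OF a, of x i], of "- m\<^sup>2"]
    by (intro partial_eqI) simp
  then show ?case by (simp add: wave_op_partial[OF a])
qed

section \<open>Symmetry and conservation\<close>

lemma U_tensor_commute: "U_tensor m \<phi> \<alpha> \<beta> \<mu>s \<nu>s x = U_tensor m \<phi> \<beta> \<alpha> \<mu>s \<nu>s x"
  by (simp add: U_tensor_def minkowski_def add.commute)

text \<open>This is the product rule with a constant metric. The factor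
  \<open>minkowski $ \<alpha> $ \<beta>\<close> leads the trace part so that
  \<open>sum_minkowski'\<close> can contract it once \<open>\<gamma>\<close> is set to
  \<open>\<alpha>\<close>.\<close>

lemma partial_U_tensor:
  fixes \<mu>s \<nu>s :: "4 list"
  assumes f: "smooth \<phi>"
  defines "a \<equiv> partials \<mu>s \<phi>" and "b \<equiv> partials \<nu>s \<phi>" and "g \<equiv> \<lambda>\<alpha>. minkowski $ \<alpha> $ \<alpha>"
  shows "partial \<gamma> (U_tensor m \<phi> \<alpha> \<beta> \<mu>s \<nu>s) x =
    1/2 * g \<alpha> * g \<beta> * (partial \<gamma> (partial \<alpha> a) x * partial \<beta> b x + partial \<alpha> a x * partial \<gamma> (partial \<beta> b) x
      + partial \<gamma> (partial \<beta> a) x * partial \<alpha> b x + partial \<beta> a x * partial \<gamma> (partial \<alpha> b) x)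
    - minkowski $ \<alpha> $ \<beta> * (1/2 * ((\<Sum>\<kappa>\<in>UNIV. g \<kappa> * (partial \<gamma> (partial \<kappa> a) x * partial \<kappa> b x
        + partial \<kappa> a x * partial \<gamma> (partial \<kappa> b) x))
      - m\<^sup>2 * (partial \<gamma> a x * b x + a x * partial \<gamma> b x)))"
proof -
  have s: "smooth a" "smooth b" "\<And>\<kappa>. smooth (partial \<kappa> a)" "\<And>\<kappa>. smooth (partial \<kappa> b)"
    using smooth_partials[OF f, of \<mu>s] smooth_partials[OF f, of \<nu>s]
      smooth_partials[OF f, of "\<kappa> # \<mu>s" for \<kappa>] smooth_partials[OF f, of "\<kappa> # \<nu>s" for \<kappa>]
    by (simp_all add: a_def b_def)
  note D = s[THEN has_real_derivative_partial_0]
  show ?thesis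
    unfolding U_tensor_def upper_partials_eq partials_Cons
    unfolding a_def[symmetric] b_def[symmetric]
    apply (rule partial_eqI)
    apply (rule derivative_eq_intros D refl)+
    apply (simp add: g_def algebra_simps sum.distrib sum_distrib_left)
    done
qed

lemma divergence_U_tensor:
  assumes f: "smooth \<phi>" and kg: "\<And>x. wave_op \<phi> x + m\<^sup>2 * \<phi> x = 0"
  shows "(\<Sum>\<alpha>\<in>UNIV. partial \<alpha> (U_tensor m \<phi> \<alpha> \<beta> \<mu>s \<nu>s) x) = 0"
proof -
  define a b g where "a = partials \<mu>s \<phi>" and "b = partials \<nu>s \<phi>" and "g = (\<lambda>\<alpha>. minkowski $ \<alpha> $ \<alpha>)"
  have smooth: "smooth a" "smooth b"
    using smooth_partials[OF f] by (simp_all add: a_def b_def)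
  have comm: "partial \<beta> (partial \<alpha> a) x = partial \<alpha> (partial \<beta> a) x"
    "partial \<beta> (partial \<alpha> b) x = partial \<alpha> (partial \<beta> b) x" for \<alpha>
    using smooth by (simp_all add: partial_commute)
  have kg': "(\<Sum>\<alpha>\<in>UNIV. g \<alpha> * partial \<alpha> (partial \<alpha> a) x) = - m\<^sup>2 * a x"
    "(\<Sum>\<alpha>\<in>UNIV. g \<alpha> * partial \<alpha> (partial \<alpha> b) x) = - m\<^sup>2 * b x"
    using klein_gordon_partials[OF f kg, of \<mu>s x] klein_gordon_partials[OF f kg, of \<nu>s x]
    by (simp_all add: wave_op_eq a_def b_def g_def)
  have "(\<Sum>\<alpha>\<in>UNIV. partial \<alpha> (U_tensor m \<phi> \<alpha> \<beta> \<mu>s \<nu>s) x) =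
      1/2 * g \<beta> * ((\<Sum>\<alpha>\<in>UNIV. g \<alpha> * partial \<alpha> (partial \<alpha> a) x) * partial \<beta> b x
        + partial \<beta> a x * (\<Sum>\<alpha>\<in>UNIV. g \<alpha> * partial \<alpha> (partial \<alpha> b) x)
        + (\<Sum>\<alpha>\<in>UNIV. g \<alpha> * (partial \<alpha> (partial \<beta> a) x * partial \<alpha> b x + partial \<alpha> a x * partial \<alpha> (partial \<beta> b) x)))
      - g \<beta> * (1/2 * ((\<Sum>\<kappa>\<in>UNIV. g \<kappa> * (partial \<beta> (partial \<kappa> a) x * partial \<kappa> b x
          + partial \<kappa> a x * partial \<beta> (partial \<kappa> b) x))
        - m\<^sup>2 * (partial \<beta> a x * b x + a x * partial \<beta> b x)))"
    unfolding partial_U_tensor[OF f] sum_subtractf sum_minkowski'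
    by (simp add: a_def b_def g_def algebra_simps sum.distrib sum_distrib_left)
  also have "\<dots> = 0"
    \<comment> \<open>The two wave-operator sums become mass terms that cancel the differentiated
      mass part; after commuting derivatives, the mixed sum cancels the differentiated kinetic
      part.\<close>
    unfolding kg' comm by (simp add: algebra_simps)
  finally show ?thesis .
qed

section \<open>Positivity of the energy density\<close>

text \<open>A reversed Cauchy-Schwarz inequality. Here \<open>v\<close> is a covector, so its
  pairing with \<open>u\<close> involves no metric. In the rest frame of \<open>u\<close> the right
  side is the time component squared; the proof completes a square instead of changing
  frames.\<close>

lemma minkowski_le_timelike:
  fixes u v :: "real^4"
  assumes "timelike_unit u"
  shows "(\<Sum>\<alpha>\<in>UNIV. minkowski $ \<alpha> $ \<alpha> * (v $ \<alpha>)\<^sup>2) \<le> (\<Sum>\<alpha>\<in>UNIV. u $ \<alpha> * v $ \<alpha>)\<^sup>2"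
proof -
  define r s n where "r = (u $ 1)\<^sup>2 + (u $ 2)\<^sup>2 + (u $ 3)\<^sup>2"
    and "s = u $ 1 * v $ 1 + u $ 2 * v $ 2 + u $ 3 * v $ 3"
    and "n = (v $ 1)\<^sup>2 + (v $ 2)\<^sup>2 + (v $ 3)\<^sup>2"
  have u0: "(u $ 0)\<^sup>2 = 1 + r"
    using assms by (simp add: timelike_unit_def minkowski_def sum_UNIV_4 r_def power2_eq_square)
  have cs: "s\<^sup>2 \<le> r * n"
  proof -
    \<comment> \<open>Lagrange's identity: the difference is the squared length of the spatial cross
      product.\<close>
    have "r * n - s\<^sup>2 = (u $ 1 * v $ 2 - u $ 2 * v $ 1)\<^sup>2 + (u $ 1 * v $ 3 - u $ 3 * v $ 1)\<^sup>2
        + (u $ 2 * v $ 3 - u $ 3 * v $ 2)\<^sup>2"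
      unfolding r_def s_def n_def by algebra
    moreover have "\<dots> \<ge> 0" by simp
    ultimately show ?thesis by linarith
  qed
  have "r \<ge> 0" "n \<ge> 0" by (simp_all add: r_def n_def)
  have "0 \<le> r * (v $ 0)\<^sup>2 + 2 * u $ 0 * v $ 0 * s + s\<^sup>2 + n"
  \<comment> \<open>If \<open>r = 0\<close>, then \<open>cs\<close> forces \<open>s = 0\<close>.
    Otherwise multiplying by \<open>r\<close> makes it possible to complete the square.\<close>
  proof (cases "r = 0")
    case True
    then show ?thesis using cs \<open>n \<ge> 0\<close> by simp
  next
    case False
    with \<open>r \<ge> 0\<close> have "r > 0" by simp
    have "r * (r * (v $ 0)\<^sup>2 + 2 * u $ 0 * v $ 0 * s + s\<^sup>2 + n)
        = (r * v $ 0 + u $ 0 * s)\<^sup>2 + (r * n - s\<^sup>2)"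
      using u0 by algebra
    also have "\<dots> \<ge> 0" using cs by simp
    finally show ?thesis using \<open>r > 0\<close> by (simp add: zero_le_mult_iff)
  qed
  moreover have "(u $ 0 * v $ 0 + s)\<^sup>2 - ((v $ 0)\<^sup>2 - n) = r * (v $ 0)\<^sup>2 + 2 * u $ 0 * v $ 0 * s + s\<^sup>2 + n"
    using u0 by algebra
  moreover have "(\<Sum>\<alpha>\<in>UNIV. minkowski $ \<alpha> $ \<alpha> * (v $ \<alpha>)\<^sup>2) = (v $ 0)\<^sup>2 - n"
    by (simp add: minkowski_def sum_UNIV_4 n_def)
  moreover have "(\<Sum>\<alpha>\<in>UNIV. u $ \<alpha> * v $ \<alpha>) = u $ 0 * v $ 0 + s"
    by (simp add: sum_UNIV_4 s_def)
  ultimately show ?thesis by simp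
qed

lemma lower_index_nth: "lower_index u $ \<alpha> = minkowski $ \<alpha> $ \<alpha> * u $ \<alpha>"
  by (simp add: lower_index_def sum_minkowski)

lemma minkowski_diag_square: "minkowski $ \<alpha> $ \<alpha> * (minkowski $ \<alpha> $ \<alpha> * y) = y"
  by (simp add: minkowski_def)

lemma minkowski_raise_both: "minkowski $ \<alpha> $ \<alpha> * (minkowski $ \<alpha> $ \<beta> * minkowski $ \<beta> $ \<beta>) = minkowski $ \<alpha> $ \<beta>"
  by (simp add: minkowski_def)

lemma sum_lower_index_minkowski:
  assumes "timelike_unit u"
  shows "(\<Sum>\<alpha>\<in>UNIV. \<Sum>\<beta>\<in>UNIV. minkowski $ \<alpha> $ \<beta> * (lower_index u $ \<alpha> * lower_index u $ \<beta>)) = 1"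
  using assms
  by (simp add: lower_index_nth timelike_unit_def mult_ac minkowski_raise_both)

text \<open>Only bilinearity matters, so the weights \<open>P\<close> and the index set
  \<open>S\<close> are arbitrary. Both index groups carry the same weights, so the result is
  quadratic: \<open>v\<close> and \<open>w\<close> are the gradient and value at \<open>x\<close> of
  one weighted sum of derivatives of \<open>\<phi>\<close>.\<close>

lemma U_tensor_contract_eq:
  fixes \<phi> :: "real^4 \<Rightarrow> real" and P :: "4 list \<Rightarrow> real" and S x
  assumes u: "timelike_unit u"
  defines "v \<equiv> \<lambda>\<alpha>. \<Sum>\<mu>s\<in>S. P \<mu>s * partial \<alpha> (partials \<mu>s \<phi>) x"
    and "w \<equiv> \<Sum>\<mu>s\<in>S. P \<mu>s * partials \<mu>s \<phi> x"
  shows "(\<Sum>\<alpha>\<in>UNIV. \<Sum>\<beta>\<in>UNIV. \<Sum>\<mu>s\<in>S. \<Sum>\<nu>s\<in>S.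
      U_tensor m \<phi> \<alpha> \<beta> \<mu>s \<nu>s x * lower_index u $ \<alpha> * lower_index u $ \<beta> * P \<mu>s * P \<nu>s)
    = (\<Sum>\<alpha>\<in>UNIV. u $ \<alpha> * v \<alpha>)\<^sup>2 - 1/2 * ((\<Sum>\<alpha>\<in>UNIV. minkowski $ \<alpha> $ \<alpha> * (v \<alpha>)\<^sup>2) - m\<^sup>2 * w\<^sup>2)"
proof -
  let ?g = "\<lambda>\<alpha>. minkowski $ \<alpha> $ \<alpha>" and ?l = "\<lambda>\<alpha>. lower_index u $ \<alpha>"
  let ?a = "\<lambda>\<mu>s. partials \<mu>s \<phi>"
  let ?E = "(\<Sum>\<kappa>\<in>UNIV. ?g \<kappa> * (v \<kappa>)\<^sup>2) - m\<^sup>2 * w\<^sup>2"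
  have vv: "v \<alpha> * v \<beta> = (\<Sum>\<mu>s\<in>S. \<Sum>\<nu>s\<in>S. P \<mu>s * P \<nu>s * (partial \<alpha> (?a \<mu>s) x * partial \<beta> (?a \<nu>s) x))" for \<alpha> \<beta>
    unfolding v_def sum_product by (simp add: mult_ac)
  have ww: "w\<^sup>2 = (\<Sum>\<mu>s\<in>S. \<Sum>\<nu>s\<in>S. P \<mu>s * P \<nu>s * (?a \<mu>s x * ?a \<nu>s x))"
    unfolding w_def power2_eq_square sum_product by (simp add: mult_ac)
  have E: "?E = (\<Sum>\<mu>s\<in>S. \<Sum>\<nu>s\<in>S. P \<mu>s * P \<nu>s *
      ((\<Sum>\<kappa>\<in>UNIV. ?g \<kappa> * partial \<kappa> (?a \<mu>s) x * partial \<kappa> (?a \<nu>s) x) - m\<^sup>2 * ?a \<mu>s x * ?a \<nu>s x))"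
  proof -
    have "(\<Sum>\<kappa>\<in>UNIV. ?g \<kappa> * (v \<kappa>)\<^sup>2) = (\<Sum>\<mu>s\<in>S. \<Sum>\<nu>s\<in>S. \<Sum>\<kappa>\<in>UNIV.
        ?g \<kappa> * (P \<mu>s * P \<nu>s * (partial \<kappa> (?a \<mu>s) x * partial \<kappa> (?a \<nu>s) x)))"
      unfolding power2_eq_square vv sum_distrib_left
      \<comment> \<open>Two exchanges move the sum over \<open>\<kappa>\<close> from outermost to
        innermost.\<close>
      by (subst sum.swap, rule sum.cong[OF refl], rule sum.swap)
    then show ?thesis
      by (simp add: ww right_diff_distrib sum_subtractf sum_distrib_left mult_ac)
  qed
  have inner: "(\<Sum>\<mu>s\<in>S. \<Sum>\<nu>s\<in>S. U_tensor m \<phi> \<alpha> \<beta> \<mu>s \<nu>s x * ?l \<alpha> * ?l \<beta> * P \<mu>s * P \<nu>s)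
      = (u $ \<alpha> * v \<alpha>) * (u $ \<beta> * v \<beta>) - 1/2 * ?E * (minkowski $ \<alpha> $ \<beta> * (?l \<alpha> * ?l \<beta>))" for \<alpha> \<beta>
  proof -
    have "(\<Sum>\<mu>s\<in>S. \<Sum>\<nu>s\<in>S. U_tensor m \<phi> \<alpha> \<beta> \<mu>s \<nu>s x * ?l \<alpha> * ?l \<beta> * P \<mu>s * P \<nu>s)
      = ?l \<alpha> * ?l \<beta> * (1/2 * (?g \<alpha> * ?g \<beta> * (v \<alpha> * v \<beta> + v \<beta> * v \<alpha>)) - 1/2 * minkowski $ \<alpha> $ \<beta> * ?E)"
      unfolding E vv sum_distrib_left sum.distrib[symmetric] sum_subtractf[symmetric]
      by (intro sum.cong refl) (simp add: U_tensor_def upper_partials_eq algebra_simps)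
    \<comment> \<open>Each lowered \<open>u\<close> meets a raised gradient index; the two metric
      factors multiply to 1, leaving the plain pairing of \<open>u\<close> with
      \<open>v\<close>.\<close>
    also have "\<dots> = (?g \<alpha> * (?g \<alpha> * u $ \<alpha>)) * (?g \<beta> * (?g \<beta> * u $ \<beta>)) * (v \<alpha> * v \<beta>)
        - 1/2 * ?E * (minkowski $ \<alpha> $ \<beta> * (?l \<alpha> * ?l \<beta>))"
      unfolding lower_index_nth by (simp add: algebra_simps)
    finally show ?thesis
      unfolding minkowski_diag_square by (simp add: mult_ac)
  qed
  have "(\<Sum>\<alpha>\<in>UNIV. \<Sum>\<beta>\<in>UNIV. (u $ \<alpha> * v \<alpha>) * (u $ \<beta> * v \<beta>)) = (\<Sum>\<alpha>\<in>UNIV. u $ \<alpha> * v \<alpha>)\<^sup>2"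
    by (simp add: power2_eq_square sum_product)
  \<comment> \<open>Normalisation of \<open>u\<close> enters here: the metric contracted with two
    lowered copies of \<open>u\<close> is 1.\<close>
  moreover have "(\<Sum>\<alpha>\<in>UNIV. \<Sum>\<beta>\<in>UNIV. 1/2 * ?E * (minkowski $ \<alpha> $ \<beta> * (?l \<alpha> * ?l \<beta>))) = 1/2 * ?E"
    unfolding sum_distrib_left[symmetric] sum_lower_index_minkowski[OF u] by simp
  ultimately show ?thesis
    unfolding inner sum_subtractf by simp
qed

lemma U_tensor_contract_nonneg:
  assumes "timelike_unit u"
  shows "(\<Sum>\<alpha>\<in>UNIV. \<Sum>\<beta>\<in>UNIV. \<Sum>\<mu>s\<in>S. \<Sum>\<nu>s\<in>S.
      U_tensor m \<phi> \<alpha> \<beta> \<mu>s \<nu>s x * lower_index u $ \<alpha> * lower_index u $ \<beta> * P \<mu>s * P \<nu>s) \<ge> 0"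
proof -
  define v where "v = (\<lambda>\<alpha>. \<Sum>\<mu>s\<in>S. P \<mu>s * partial \<alpha> (partials \<mu>s \<phi>) x)"
  have "(\<Sum>\<alpha>\<in>UNIV. minkowski $ \<alpha> $ \<alpha> * (v \<alpha>)\<^sup>2) \<le> (\<Sum>\<alpha>\<in>UNIV. u $ \<alpha> * v \<alpha>)\<^sup>2"
    using minkowski_le_timelike[OF assms, of "\<chi> \<alpha>. v \<alpha>"] by simp
  moreover have "0 \<le> (\<Sum>\<alpha>\<in>UNIV. u $ \<alpha> * v \<alpha>)\<^sup>2" "0 \<le> m\<^sup>2 * (\<Sum>\<mu>s\<in>S. P \<mu>s * partials \<mu>s \<phi> x)\<^sup>2"
    by simp_all
  \<comment> \<open>\<open>A\<close> is the squared Minkowski length of \<open>v\<close>,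
    \<open>B\<close> its squared pairing with \<open>u\<close>, and \<open>C\<close> the mass
    term.\<close>
  moreover have "0 \<le> B - 1/2 * (A - C)" if "A \<le> B" "0 \<le> B" "0 \<le> C" for A B C :: real
    using that by simp
  ultimately show ?thesis
    unfolding U_tensor_contract_eq[OF assms] v_def by blast
qed

theorem mainTheorem7:
  fixes m :: real and \<phi> :: "real^4 \<Rightarrow> real"
  assumes "m \<ge> 0"
    and "smooth \<phi>"
    and "\<forall>x. wave_op \<phi> x + m\<^sup>2 * \<phi> x = 0"
  shows "(\<forall>(p::nat) (q::nat) \<mu>s \<nu>s. length \<mu>s = p \<and> length \<nu>s = q \<longrightarrow>
            (\<forall>\<alpha> \<beta> x. U_tensor m \<phi> \<alpha> \<beta> \<mu>s \<nu>s x = U_tensor m \<phi> \<beta> \<alpha> \<mu>s \<nu>s x) \<and>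
            (\<forall>\<sigma>. \<sigma> permutes {..<p} \<longrightarrow>
               (\<forall>\<alpha> \<beta> x. U_tensor m \<phi> \<alpha> \<beta> (permute_list \<sigma> \<mu>s) \<nu>s x = U_tensor m \<phi> \<alpha> \<beta> \<mu>s \<nu>s x)) \<and>
            (\<forall>\<sigma>. \<sigma> permutes {..<q} \<longrightarrow>
               (\<forall>\<alpha> \<beta> x. U_tensor m \<phi> \<alpha> \<beta> \<mu>s (permute_list \<sigma> \<nu>s) x = U_tensor m \<phi> \<alpha> \<beta> \<mu>s \<nu>s x)) \<and>
            (\<forall>\<beta> x. (\<Sum>\<alpha>\<in>UNIV. partial \<alpha> (U_tensor m \<phi> \<alpha> \<beta> \<mu>s \<nu>s) x) = 0))
       \<and> (\<forall>(n::nat) u x. timelike_unit u \<longrightarrow>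
            (\<Sum>\<alpha>\<in>UNIV. \<Sum>\<beta>\<in>UNIV. \<Sum>\<mu>s\<in>{\<mu>s. length \<mu>s = n}. \<Sum>\<nu>s\<in>{\<nu>s. length \<nu>s = n}.
               U_tensor m \<phi> \<alpha> \<beta> \<mu>s \<nu>s x * lower_index u $ \<alpha> * lower_index u $ \<beta> *
               (\<Prod>i<n. u $ (\<mu>s ! i)) * (\<Prod>i<n. u $ (\<nu>s ! i))) \<ge> 0)"
proof -
  have kg: "wave_op \<phi> x + m\<^sup>2 * \<phi> x = 0" for x
    using assms(3) by blast
  have "U_tensor m \<phi> \<alpha> \<beta> (permute_list \<sigma> \<mu>s) \<nu>s x = U_tensor m \<phi> \<alpha> \<beta> \<mu>s \<nu>s x"
    if "\<sigma> permutes {..<length \<mu>s}" for \<sigma> \<alpha> \<beta> \<mu>s \<nu>s x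
    using that
    by (simp add: U_tensor_def upper_partials_permute_list[OF assms(2)] partials_permute_list[OF assms(2)])
  moreover have "U_tensor m \<phi> \<alpha> \<beta> \<mu>s (permute_list \<sigma> \<nu>s) x = U_tensor m \<phi> \<alpha> \<beta> \<mu>s \<nu>s x"
    if "\<sigma> permutes {..<length \<nu>s}" for \<sigma> \<alpha> \<beta> \<mu>s \<nu>s x
    using that
    by (simp add: U_tensor_def upper_partials_permute_list[OF assms(2)] partials_permute_list[OF assms(2)])
  \<comment> \<open>The positivity lemma is used with \<open>S\<close> the lists of length
    \<open>n\<close> and \<open>P\<close> the product of the components of \<open>u\<close> along a
    list.\<close>
  moreover note U_tensor_commute divergence_U_tensor[OF assms(2) kg] U_tensor_contract_nonneg
  ultimately show ?thesis
    by (intro conjI allI impI) (simp only: | blast)+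
qed

end
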